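(* For $k\ge3$ there does not exist any subset $P\subset\mathbb{R}^k$ such that $P+\mathfrak{P}=\mathbb{R}^k$ and $(r+\mathfrak{P}^\circ)\cap(s+\mathfrak{P}^\circ)=\emptyset$ for all $r,s\in P$ with $r\ne s$. Hence in particular, $\tilde\rho_k>\frac12(k!)^{1/k}$ for $k\ge3$.
   Context: $\mathfrak{P}=\{x\in\mathbb{R}^k:|x_1|+\cdots+|x_k|\le1\}$ and $\mathfrak{P}^\circ$ is its interior. $X_k$ is the set of all ($k$-dimensional) lattices $L\subset\mathbb{R}^k$ of covolume one. For a lattice $L\subset\mathbb{R}^k$, $\rho(\mathfrak{P},L)=\inf\{r>0: r\mathfrak{P}+L=\mathbb{R}^k\}$ (the covering radius), and $\tilde\rho_k:=\inf_{L\in X_k}\rho(\mathfrak{P},L)$. *)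

theory Defs
  imports "HOL-Analysis.Analysis"
begin

definition cross_polytope :: "(real ^ 'n) set" where
  "cross_polytope = {x. (\<Sum>i\<in>UNIV. \<bar>x $ i\<bar>) \<le> 1}"

text \<open>The columns of \<open>A\<close> are a \<open>\<int>\<close>-basis of the full-rank lattice \<open>L\<close>.\<close>

definition lattice_basis :: "real ^ 'n ^ 'n \<Rightarrow> (real ^ 'n) set \<Rightarrow> bool" where
  "lattice_basis A L \<longleftrightarrow> invertible A \<and> L = (*v) A ` {z. \<forall>i. z $ i \<in> \<int>}"

definition is_lattice :: "(real ^ 'n) set \<Rightarrow> bool" where
  "is_lattice L \<longleftrightarrow> (\<exists>A. lattice_basis A L)"

definition covolume :: "(real ^ 'n) set \<Rightarrow> real" where
  "covolume L = (THE d. \<exists>A. lattice_basis A L \<and> d = \<bar>det A\<bar>)"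

lemma lattice_basis_change:
  assumes "lattice_basis A L" "lattice_basis B L"
  obtains U where "B = A ** U" "\<And>i j. U $ i $ j \<in> \<int>"
proof -
  have "\<exists>z. (\<forall>i. z $ i \<in> \<int>) \<and> column j B = A *v z" for j
  proof -
    have "B *v axis j 1 \<in> L"
      using assms(2) by (auto simp: lattice_basis_def axis_def intro!: imageI)
    then show ?thesis
      using assms(1) by (auto simp: lattice_basis_def matrix_vector_mult_basis)
  qed
  then obtain z where z: "\<And>j i. z j $ i \<in> \<int>" "\<And>j. column j B = A *v z j"
    by metis
  show thesis
  proof (rule that[of "\<chi> i j. z j $ i"])
    show "B = A ** (\<chi> i j. z j $ i)"
      using z(2) by (simp add: vec_eq_iff column_def matrix_matrix_mult_def matrix_vector_mult_def)
  qed (use z(1) in simp)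
qed

lemma det_Ints:
  fixes U :: "real ^ 'n ^ 'n"
  assumes "\<And>i j. U $ i $ j \<in> \<int>"
  shows "det U \<in> \<int>"
  unfolding det_def by (intro Ints_sum Ints_mult Ints_prod Ints_of_int assms)

lemma abs_det_lattice_basis_unique:
  fixes A B :: "real ^ 'n ^ 'n"
  assumes "lattice_basis A L" "lattice_basis B L"
  shows "\<bar>det A\<bar> = \<bar>det B\<bar>"
proof -
  have le: "\<bar>det A\<bar> \<le> \<bar>det B\<bar>" if AB: "lattice_basis A L" "lattice_basis B L" for A B :: "real ^ 'n ^ 'n"
  proof -
    obtain U where U: "B = A ** U" "\<And>i j. U $ i $ j \<in> \<int>"
      using lattice_basis_change[OF AB] by metis
    have "det B \<noteq> 0"
      using AB(2) by (simp add: lattice_basis_def invertible_det_nz)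
    then have "1 \<le> \<bar>det U\<bar>"
      using U det_Ints[OF U(2)] by (intro Ints_nonzero_abs_ge1) (auto simp: det_mul)
    then show ?thesis
      using U(1) mult_left_mono[of 1 "\<bar>det U\<bar>" "\<bar>det A\<bar>"] by (simp add: det_mul abs_mult)
  qed
  show ?thesis
    using le assms by (meson antisym)
qed

lemma covolume_eq: "lattice_basis A L \<Longrightarrow> covolume L = \<bar>det A\<bar>"
  unfolding covolume_def by (rule the_equality) (auto dest: abs_det_lattice_basis_unique)

definition unimodular_lattices :: "(real ^ 'n) set set" where
  "unimodular_lattices = {L. is_lattice L \<and> covolume L = 1}"

definition covering_radius :: "(real ^ 'n) set \<Rightarrow> (real ^ 'n) set \<Rightarrow> real" where
  "covering_radius K L = Inf {r. r > 0 \<and> (*\<^sub>R) r ` K + L = UNIV}"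

definition min_covering_radius :: "(real ^ 'n) set \<Rightarrow> real" where
  "min_covering_radius K = (INF L\<in>unimodular_lattices. covering_radius K L)"

end

theory Submission imports Defs begin

text \<open>
  Write \<open>C\<close> for the cross-polytope, the unit ball of the norm \<open>l1\<close>, and \<open>k\<close> for the dimension. Translates
  \<open>p + C\<close> and \<open>q + C\<close> have disjoint interiors only if \<open>l1 (p - q) \<ge> 2\<close>.

  For the first claim, look at a point \<open>x\<close> on the ridge of \<open>C\<close> where \<open>x\<^sub>1 = 0\<close>, the other coordinates are
  non-negative, and their sum is \<open>1\<close>. Pushing \<open>x\<close> slightly in direction \<open>\<plusminus>e\<^sub>1\<close> leaves \<open>C\<close>, so the
  two pushed points lie in translates with centres \<open>p\<close> and \<open>q\<close>. As the push tends to zero,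
  both \<open>p + C\<close> and \<open>q + C\<close> come to touch \<open>C\<close> at \<open>x\<close>, which puts \<open>x\<close> on a shortest \<open>l1\<close>-path from \<open>0\<close> to \<open>p\<close> and to \<open>q\<close>: the coordinates of
  the centres dominate those of \<open>x\<close>, and \<open>p\<^sub>1 > 0 > q\<^sub>1\<close>. If \<open>p\<close> and \<open>q\<close> both strictly exceed \<open>x\<close>
  in one further coordinate, there the two centres are closer to one another than the detour through
  \<open>x\<close> suggests, and \<open>l1 (p - q) < 2\<close>. The strictness is where \<open>k \<ge> 3\<close> enters: then the ridge has
  positive dimension, so a coordinate of \<open>x\<close> can be moved away from the finitely many values taken by
  nearby centres. In the plane the ridge is a vertex, and squares do tile.

  The argument survives small errors, and a version with a tolerance is what is proved
  (\<open>covering_is_not_nearly_packing\<close>): there is \<open>e > 0\<close>, depending on \<open>k\<close> alone, such that every set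
  \<open>S\<close> with \<open>S + C = UNIV\<close> has two distinct points at \<open>l1\<close>-distance less than \<open>2 - e\<close>. The pigeonhole
  principle, applied to a bound on the number of nearby centres, replaces the genericity of \<open>x\<close>.

  The uniform tolerance also yields the strict bound on the infimum over all lattices. If
  \<open>r C + L = UNIV\<close> with \<open>L\<close> of covolume one, then \<open>L\<close> contains some \<open>v \<noteq> 0\<close> with \<open>l1 v < (2 - e) r\<close>. The part of \<open>r C\<close> that overlaps \<open>v + r C\<close> is
  superfluous for the covering (\<open>covering_without_overlap\<close>), and it contains a copy of \<open>r C\<close> scaled by
  \<open>e / 2\<close>. What remains has volume at least the covolume (\<open>lattice_covering_volume\<close>), and the volume of
  \<open>C\<close> is at most \<open>2 ^ k / k!\<close>; hence \<open>1 \<le> (1 - (e / 2) ^ k) (2 r) ^ k / k!\<close>, which bounds \<open>r\<close> away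
  from \<open>(k!) powr (1 / k) / 2\<close> independently of \<open>L\<close>.
\<close>

section \<open>The norm whose unit ball is the cross-polytope\<close>

definition l1 :: "real ^ 'n \<Rightarrow> real" where
  "l1 x = (\<Sum>i\<in>UNIV. \<bar>x $ i\<bar>)"

lemma cross_polytope_iff: "x \<in> cross_polytope \<longleftrightarrow> l1 x \<le> 1"
  by (simp add: cross_polytope_def l1_def)

lemma l1_zero [simp]: "l1 0 = 0"
  by (simp add: l1_def)

lemma l1_minus [simp]: "l1 (- x) = l1 x"
  by (simp add: l1_def)

lemma l1_minus_commute: "l1 (x - y) = l1 (y - x)"
  by (simp add: l1_def abs_minus_commute)

lemma l1_triangle: "l1 (x + y) \<le> l1 x + l1 y"
  unfolding l1_def sum.distrib[symmetric] by (intro sum_mono) auto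

lemma l1_diff_triangle: "l1 (x - z) \<le> l1 (x - y) + l1 (y - z)"
  using l1_triangle[of "x - y" "y - z"] by simp

lemma l1_scaleR [simp]: "l1 (c *\<^sub>R x) = \<bar>c\<bar> * l1 x"
  by (simp add: l1_def abs_mult sum_distrib_left)

lemma l1_split: "l1 x = \<bar>x $ i\<bar> + (\<Sum>m\<in>UNIV - {i}. \<bar>x $ m\<bar>)"
  unfolding l1_def by (rule sum.remove) auto

lemma continuous_on_l1: "continuous_on S l1"
  unfolding l1_def[abs_def]
  by (intro continuous_on_sum continuous_on_rabs continuous_on_component continuous_on_id)

lemma compact_l1_ball: "compact {x. l1 x \<le> c}"
proof -
  have "norm x \<le> l1 x" for x :: "real ^ 'n"
    unfolding l1_def by (rule norm_le_l1_cart)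
  then have "bounded {x :: real ^ 'n. l1 x \<le> c}"
    unfolding bounded_iff by (meson mem_Collect_eq order_trans)
  moreover have "closed {x :: real ^ 'n. l1 x \<le> c}"
    by (intro closed_Collect_le continuous_on_l1 continuous_intros)
  ultimately show ?thesis
    by (simp add: compact_eq_bounded_closed)
qed

lemma mem_scaled_cross_polytope:
  assumes "r > 0"
  shows "x \<in> (*\<^sub>R) r ` cross_polytope \<longleftrightarrow> l1 x \<le> r"
proof
  assume "l1 x \<le> r"
  then have "x = r *\<^sub>R (x /\<^sub>R r)" "x /\<^sub>R r \<in> cross_polytope"
    using assms by (auto simp: cross_polytope_iff field_simps)
  then show "x \<in> (*\<^sub>R) r ` cross_polytope" by blast
qed (use assms in \<open>auto simp: cross_polytope_iff mult_left_le\<close>)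

lemma compact_scaled_cross_polytope:
  assumes "r > 0"
  shows "compact ((*\<^sub>R) r ` cross_polytope)"
proof -
  have "(*\<^sub>R) r ` cross_polytope = {x. l1 x \<le> r}"
    using mem_scaled_cross_polytope[OF assms] by blast
  then show ?thesis using compact_l1_ball by metis
qed

lemma l1_ball_subset_interior: "{x. l1 x < 1} \<subseteq> interior cross_polytope"
  by (rule interior_maximal)
    (auto simp: cross_polytope_iff intro!: open_Collect_less continuous_on_l1 continuous_intros)

section \<open>Coverings by cross-polytopes have overlaps of definite size\<close>

text \<open>Finitely many balls of radius \<open>1/2\<close> cover the compact region, and each contains at most one point of
  \<open>F\<close>. The point is that \<open>N\<close> does not depend on \<open>F\<close>.\<close>

lemma packing_bound:
  "\<exists>N. \<forall>F :: (real ^ 'n) set. F \<subseteq> {x. l1 x \<le> c} \<and> (\<forall>p\<in>F. \<forall>q\<in>F. p \<noteq> q \<longrightarrow> 1 \<le> l1 (p - q))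
     \<longrightarrow> finite F \<and> card F \<le> N"
proof -
  define U where "U t = {x :: real ^ 'n. l1 (x - t) < 1/2}" for t
  have "open (U t)" for t
    unfolding U_def l1_def by (intro open_Collect_less continuous_intros)
  moreover have "{x. l1 x \<le> c} \<subseteq> (\<Union>t\<in>UNIV. U t)"
  proof
    fix x :: "real ^ 'n"
    have "x \<in> U x" by (simp add: U_def)
    then show "x \<in> (\<Union>t\<in>UNIV. U t)" by blast
  qed
  ultimately obtain T where T: "finite T" "{x. l1 x \<le> c} \<subseteq> (\<Union>t\<in>T. U t)"
    using compactE_image[OF compact_l1_ball, of UNIV U c] by metis
  have "finite F \<and> card F \<le> card T"
    if F: "F \<subseteq> {x. l1 x \<le> c}" "\<forall>p\<in>F. \<forall>q\<in>F. p \<noteq> q \<longrightarrow> 1 \<le> l1 (p - q)" for F :: "(real ^ 'n) set"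
  proof -
    have "\<forall>p\<in>F. \<exists>t\<in>T. p \<in> U t"
      using F(1) T(2) by blast
    then obtain f where f: "\<And>p. p \<in> F \<Longrightarrow> f p \<in> T \<and> p \<in> U (f p)"
      by metis
    have "inj_on f F"
    proof (rule inj_onI, rule ccontr)
      fix p q assume pq: "p \<in> F" "q \<in> F" "f p = f q" "p \<noteq> q"
      have "l1 (p - q) \<le> l1 (p - f p) + l1 (q - f q)"
        using l1_diff_triangle[of p q "f p"] pq(3) by (simp add: l1_minus_commute)
      also have "\<dots> < 1"
        using f[OF pq(1)] f[OF pq(2)] by (simp add: U_def)
      finally show False
        using F(2) pq by fastforce
    qed
    moreover have "f ` F \<subseteq> T" using f by blast
    ultimately show ?thesis
      using T(1) by (meson card_inj_on_le inj_on_finite)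
  qed
  then show ?thesis by blast
qed

text \<open>Here \<open>x\<close> lies on the ridge, and \<open>p\<close> is the centre of a translate containing \<open>x\<close> pushed by \<open>d\<close> out
  of the cross-polytope at the origin. The excess of the path from \<open>0\<close> through \<open>x\<close> to \<open>p\<close> over the
  distance \<open>l1 p\<close> is a sum of non-negative contributions \<open>E m\<close> of the coordinates other than \<open>i\<close>, and it is
  bounded by \<open>e + \<bar>p $ i\<bar> - \<bar>s * d - p $ i\<bar>\<close>, hence by \<open>e + d\<close>. The first bound would be negative if
  \<open>s * p $ i \<le> 0\<close>; the second would be violated by \<open>E j\<close> if \<open>p $ j\<close> were below \<open>x $ j\<close> by \<open>g\<close> or more.
  So the hypothesis that \<open>p $ j\<close> avoids the \<open>g\<close>-neighbourhood of \<open>x $ j\<close> forces it above.\<close>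

lemma neighbour_across_ridge:
  fixes x p :: "real ^ 'n"
  assumes ij: "i \<noteq> j" and x: "x $ i = 0" "\<And>m. 0 \<le> x $ m" "l1 x = 1"
    and sg: "\<bar>s\<bar> = 1"
    and cov: "l1 (x + axis i (s * d) - p) \<le> 1"
    and sep: "2 - e \<le> l1 p"
    and small: "0 < d" "e < d" "d + e < 2 * g" "g \<le> x $ j"
    and gap: "g \<le> \<bar>p $ j - x $ j\<bar>"
  shows "0 < s * p $ i" "x $ j + g \<le> p $ j"
    "(\<Sum>m\<in>UNIV - {i}. \<bar>p $ m - x $ m\<bar>) \<le> 1 + d - \<bar>p $ i\<bar>"
proof -
  define E where "E m = x $ m + \<bar>p $ m - x $ m\<bar> - \<bar>p $ m\<bar>" for m
  have E0: "0 \<le> E m" for m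
    using x(2)[of m] by (simp add: E_def)
  have A: "\<bar>s * d - p $ i\<bar> + (\<Sum>m\<in>UNIV - {i}. \<bar>p $ m - x $ m\<bar>) \<le> 1"
  proof -
    have "(\<Sum>m\<in>UNIV - {i}. \<bar>(x + axis i (s * d) - p) $ m\<bar>) = (\<Sum>m\<in>UNIV - {i}. \<bar>p $ m - x $ m\<bar>)"
      by (rule sum.cong) (auto simp: axis_def)
    then show ?thesis
      using cov l1_split[of "x + axis i (s * d) - p" i] x(1) by (simp add: axis_def)
  qed
  have B: "2 - e \<le> \<bar>p $ i\<bar> + (\<Sum>m\<in>UNIV - {i}. \<bar>p $ m\<bar>)"
    using sep l1_split[of p i] by simp
  have C: "(\<Sum>m\<in>UNIV - {i}. x $ m) = 1"
    using x l1_split[of x i] by simp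
  have sumE: "(\<Sum>m\<in>UNIV - {i}. E m) \<le> e + \<bar>p $ i\<bar> - \<bar>s * d - p $ i\<bar>"
    using A B C by (simp add: E_def sum.distrib sum_subtractf)
  have sumE0: "0 \<le> (\<Sum>m\<in>UNIV - {i}. E m)"
    using E0 by (simp add: sum_nonneg)
  have s: "s = 1 \<or> s = -1" using sg by linarith
  then have sd: "\<bar>p $ i\<bar> - \<bar>s * d - p $ i\<bar> \<le> d" using small(1) by auto
  show "0 < s * p $ i"
    using s sumE sumE0 small by (auto simp: abs_if split: if_splits)
  have "E j \<le> (\<Sum>m\<in>UNIV - {i}. E m)"
    using E0 ij by (intro member_le_sum) auto
  then have "E j < 2 * g"
    using sumE sd small by linarith
  then show "x $ j + g \<le> p $ j"
    using gap small unfolding E_def by linarith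
  show "(\<Sum>m\<in>UNIV - {i}. \<bar>p $ m - x $ m\<bar>) \<le> 1 + d - \<bar>p $ i\<bar>"
    using A sd by linarith
qed

text \<open>Measuring from \<open>p\<close> to \<open>q\<close> through \<open>x\<close> gives at most \<open>2 + 2 * d\<close>. In coordinate \<open>j\<close> both centres lie on
  the same side of \<open>x\<close> at distance at least \<open>g\<close>, so the direct path saves \<open>2 * g\<close> there.\<close>

lemma opposite_neighbours_overlap:
  fixes x p q :: "real ^ 'n"
  assumes ij: "i \<noteq> j" and sides: "0 < p $ i" "q $ i < 0"
    and pj: "x $ j + g \<le> p $ j" and qj: "x $ j + g \<le> q $ j" and g: "0 \<le> g"
    and p: "(\<Sum>m\<in>UNIV - {i}. \<bar>p $ m - x $ m\<bar>) \<le> 1 + d - \<bar>p $ i\<bar>"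
    and q: "(\<Sum>m\<in>UNIV - {i}. \<bar>q $ m - x $ m\<bar>) \<le> 1 + d - \<bar>q $ i\<bar>"
  shows "l1 (p - q) \<le> 2 + 2 * d - 2 * g"
proof -
  have "(\<Sum>m\<in>UNIV - {i}. \<bar>p $ m - q $ m\<bar>)
      \<le> (\<Sum>m\<in>UNIV - {i}. \<bar>p $ m - x $ m\<bar> + \<bar>q $ m - x $ m\<bar> - (if m = j then 2 * g else 0))"
    using pj qj g by (intro sum_mono) (auto split: if_splits)
  also have "\<dots> = (\<Sum>m\<in>UNIV - {i}. \<bar>p $ m - x $ m\<bar>) + (\<Sum>m\<in>UNIV - {i}. \<bar>q $ m - x $ m\<bar>) - 2 * g"
    using ij by (simp add: sum.distrib sum_subtractf)
  finally show ?thesis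
    using p q sides l1_split[of "p - q" i] by simp
qed

text \<open>The \<open>N + 1\<close> candidates \<open>1 / (N + 2), \<dots>, (N + 1) / (N + 2)\<close> have spacing \<open>1 / (N + 2)\<close>, so each
  value in \<open>F\<close> comes closer than half of that to at most one of them.\<close>

lemma avoid_finitely_many_values:
  fixes F :: "real set"
  assumes "finite F" "card F \<le> N"
  shows "\<exists>a. 1 / (2 * (real N + 2)) \<le> a \<and> a \<le> 1 \<and> (\<forall>v\<in>F. 1 / (2 * (real N + 2)) \<le> \<bar>v - a\<bar>)"
proof (rule ccontr)
  define g where "g = 1 / (2 * (real N + 2))"
  define a where "a i = (real i + 1) * (2 * g)" for i :: nat
  have g: "0 < g" by (simp add: g_def)
  assume neg: "\<not> ?thesis"
  have "\<exists>v\<in>F. \<bar>v - a i\<bar> < g" if "i \<le> N" for i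
  proof -
    have "g \<le> a i" using g by (simp add: a_def algebra_simps)
    moreover have "a i \<le> 1" using that by (simp add: a_def g_def field_simps)
    ultimately show ?thesis
      using neg unfolding g_def[symmetric] by (meson not_le)
  qed
  then obtain h where h: "\<And>i. i \<le> N \<Longrightarrow> h i \<in> F \<and> \<bar>h i - a i\<bar> < g"
    by metis
  have "inj_on h {..N}"
  proof (rule inj_onI, rule ccontr)
    fix i k assume ik: "i \<in> {..N}" "k \<in> {..N}" "h i = h k" "i \<noteq> k"
    have "2 * g * \<bar>real i - real k\<bar> = \<bar>a i - a k\<bar>"
      using g by (simp add: a_def abs_mult flip: left_diff_distrib)
    also have "\<dots> < 2 * g * 1" using h[of i] h[of k] ik by auto
    finally have "\<bar>real i - real k\<bar> < 1" using g by simp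
    then show False using ik(4) by linarith
  qed
  then have "card {..N} \<le> card F"
    using h by (intro card_inj_on_le) (auto simp: assms)
  then show False using assms by simp
qed

text \<open>The three coordinates play different roles: \<open>i\<close> is the direction of the push, \<open>j\<close> carries the generic
  value \<open>a\<close>, and \<open>k\<close> absorbs the remaining \<open>1 - a\<close> that keeps \<open>x\<close> on the ridge.\<close>

lemma covering_is_not_nearly_packing:
  assumes "CARD('n::finite) \<ge> 3"
  shows "\<exists>e>0. e \<le> 1 \<and> (\<forall>S :: (real ^ 'n) set. S + cross_polytope = UNIV \<longrightarrow>
           (\<exists>p\<in>S. \<exists>q\<in>S. p \<noteq> q \<and> l1 (p - q) < 2 - e))"
proof -
  obtain i j k :: 'n where ijk: "i \<noteq> j" "i \<noteq> k" "j \<noteq> k"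
  proof -
    obtain A :: "'n set" where "card A = 3"
      using obtain_subset_with_card_n[OF assms] by metis
    then show thesis using that by (auto simp: card_3_iff)
  qed
  obtain N where N: "\<And>F :: (real ^ 'n) set. F \<subseteq> {x. l1 x \<le> 3} \<Longrightarrow>
      (\<forall>p\<in>F. \<forall>q\<in>F. p \<noteq> q \<longrightarrow> 1 \<le> l1 (p - q)) \<Longrightarrow> finite F \<and> card F \<le> N"
    using packing_bound[of 3] by metis
  define g where "g = 1 / (2 * (real N + 2))"
  \<comment> \<open>The push \<open>d\<close> must exceed the tolerance \<open>e\<close> for the sign of \<open>p $ i\<close> to be determined, and the final
    contradiction needs \<open>2 * d + e < 2 * g\<close>.\<close>
  define d where "d = g / 2"
  define e where "e = g / 4"
  have g: "0 < g" "g \<le> 1" by (auto simp: g_def field_simps)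
  have False if cov: "S + cross_polytope = UNIV"
    and sep: "\<And>p q. p \<in> S \<Longrightarrow> q \<in> S \<Longrightarrow> p \<noteq> q \<Longrightarrow> 2 - e \<le> l1 (p - q)"
    for S :: "(real ^ 'n) set"
  proof -
    \<comment> \<open>Centres are measured from one of them, \<open>c0\<close>, which plays the role of the origin.\<close>
    obtain c0 where c0: "c0 \<in> S"
      using cov by (blast elim: set_plus_elim)
    define F where "F = {v. c0 + v \<in> S \<and> l1 v \<le> 3}"
    have sepF: "2 - e \<le> l1 (v - w)" if "c0 + v \<in> S" "c0 + w \<in> S" "v \<noteq> w" for v w
      using sep[of "c0 + v" "c0 + w"] that by simp
    have "finite F \<and> card F \<le> N"
    proof (rule N)
      show "\<forall>p\<in>F. \<forall>q\<in>F. p \<noteq> q \<longrightarrow> 1 \<le> l1 (p - q)"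
        using sepF g by (fastforce simp: F_def e_def)
    qed (auto simp: F_def)
    then obtain a where a: "g \<le> a" "a \<le> 1" "\<And>v. v \<in> F \<Longrightarrow> g \<le> \<bar>v $ j - a\<bar>"
      using avoid_finitely_many_values[of "(\<lambda>v. v $ j) ` F" N] card_image_le[of F "\<lambda>v. v $ j"]
      unfolding g_def[symmetric] by fastforce
    define x :: "real ^ 'n" where "x = axis j a + axis k (1 - a)"
    have x: "x $ i = 0" "\<And>m. 0 \<le> x $ m" "x $ j = a"
      using ijk a g by (auto simp: x_def axis_def)
    have "l1 x = (\<Sum>m\<in>UNIV. x $ m)"
      using x(2) by (simp add: l1_def)
    then have l1x: "l1 x = 1"
      by (simp add: x_def axis_def sum.distrib)
    have nb: "\<exists>v. c0 + v \<in> S \<and> 0 < s * v $ i \<and> x $ j + g \<le> v $ j \<and>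
        (\<Sum>m\<in>UNIV - {i}. \<bar>v $ m - x $ m\<bar>) \<le> 1 + d - \<bar>v $ i\<bar>" if s: "\<bar>s\<bar> = 1" for s
    proof -
      define y where "y = x + axis i (s * d)"
      obtain u c where u: "u \<in> S" "c \<in> cross_polytope" "c0 + y = u + c"
        using cov by (blast elim: set_plus_elim)
      define v where "v = u - c0"
      have yv: "l1 (y - v) \<le> 1"
      proof -
        have "y - v = c" using u(3) by (simp add: v_def algebra_simps)
        then show ?thesis using u(2) by (simp add: cross_polytope_iff)
      qed
      have vS: "c0 + v \<in> S" using u by (simp add: v_def)
      \<comment> \<open>The pushed point is outside the cross-polytope at \<open>c0\<close>, so it is covered by another one.\<close>
      have "l1 y = 1 + d"
      proof -
        have "(\<Sum>m\<in>UNIV - {i}. \<bar>y $ m\<bar>) = (\<Sum>m\<in>UNIV - {i}. \<bar>x $ m\<bar>)"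
          by (rule sum.cong) (auto simp: y_def axis_def)
        then show ?thesis
          using l1_split[of y i] l1_split[of x i] l1x x(1) s g
          by (simp add: y_def axis_def abs_mult d_def)
      qed
      then have "v \<noteq> 0" using yv g by (auto simp: d_def)
      then have lv: "2 - e \<le> l1 v" using sepF[of v 0] vS c0 by simp
      have "l1 v \<le> l1 y + l1 (y - v)"
        using l1_diff_triangle[of v 0 y] l1_minus_commute[of v y] by simp
      then have "v \<in> F"
        using yv \<open>l1 y = 1 + d\<close> vS g by (simp add: F_def d_def)
      then have "g \<le> \<bar>v $ j - x $ j\<bar>" using a x by simp
      then show ?thesis
        using neighbour_across_ridge[OF ijk(1) x(1,2) l1x s yv[unfolded y_def] lv, of g] vS g a x
        by (auto simp: d_def e_def)
    qed
    obtain v where v: "c0 + v \<in> S" "0 < v $ i" "x $ j + g \<le> v $ j"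
        "(\<Sum>m\<in>UNIV - {i}. \<bar>v $ m - x $ m\<bar>) \<le> 1 + d - \<bar>v $ i\<bar>"
      using nb[of 1] by auto
    obtain w where w: "c0 + w \<in> S" "w $ i < 0" "x $ j + g \<le> w $ j"
        "(\<Sum>m\<in>UNIV - {i}. \<bar>w $ m - x $ m\<bar>) \<le> 1 + d - \<bar>w $ i\<bar>"
      using nb[of "-1"] by auto
    have "l1 (v - w) \<le> 2 + 2 * d - 2 * g"
      using opposite_neighbours_overlap[of i j v w x g d] ijk v w g by simp
    moreover have "2 - e \<le> l1 (v - w)"
      using sepF[of v w] v w by fastforce
    ultimately show False using g by (simp add: d_def e_def)
  qed
  then have "\<forall>S :: (real ^ 'n) set. S + cross_polytope = UNIV \<longrightarrow>
      (\<exists>p\<in>S. \<exists>q\<in>S. p \<noteq> q \<and> l1 (p - q) < 2 - e)"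
    by (meson not_le)
  then show ?thesis using g by (intro exI[of _ e]) (simp add: e_def)
qed

text \<open>Otherwise the midpoint of \<open>r\<close> and \<open>s\<close> is interior to both translates.\<close>

lemma disjoint_interiors_imp_l1_ge:
  assumes "((+) r ` interior cross_polytope) \<inter> ((+) s ` interior cross_polytope) = {}"
  shows "2 \<le> l1 (r - s)"
proof (rule ccontr)
  define h where "h = (1/2) *\<^sub>R (r - s)"
  assume "\<not> 2 \<le> l1 (r - s)"
  then have "l1 h < 1" by (simp add: h_def)
  then have "h \<in> interior cross_polytope" "- h \<in> interior cross_polytope"
    using l1_ball_subset_interior by auto
  moreover have "s + h = r + (- h)"
    using scaleR_half_double[of r] scaleR_half_double[of s]
    by (simp add: h_def vec_eq_iff field_simps)
  ultimately show False using assms by blast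
qed

section \<open>Linear images and volume\<close>

lemma det_matrix_shear:
  fixes m n :: "'n::finite"
  assumes "m \<noteq> n"
  shows "det (matrix (\<lambda>v :: real ^ 'n. \<chi> i. if i = m then v $ m + v $ n else v $ i)) = 1"
proof -
  have "matrix (\<lambda>v :: real ^ 'n. \<chi> i. if i = m then v $ m + v $ n else v $ i)
      = (\<chi> k. if k = m then row m (mat 1) + 1 *s row n (mat 1) else row k (mat 1))"
    by (auto simp: matrix_def row_def mat_def axis_def vec_eq_iff)
  then show ?thesis
    using det_row_operation[OF assms, of "mat 1 :: real ^ 'n ^ 'n" 1] by simp
qed

text \<open>\<open>measure_shear_interval\<close> concerns boxes on which the added coordinate starts at a non-negative value;
  a translation moves an arbitrary box to such a position.\<close>

lemma measure_shear_cbox: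
  fixes a b :: "real ^ 'n"
  assumes "m \<noteq> n"
  shows "measure lebesgue ((\<lambda>v. \<chi> i. if i = m then v $ m + v $ n else v $ i) ` cbox a b)
    = measure lebesgue (cbox a b)"
proof (cases "cbox a b = {}")
  case False
  let ?h = "\<lambda>v :: real ^ 'n. \<chi> i. if i = m then v $ m + v $ n else v $ i"
  define u :: "real ^ 'n" where "u = axis n (- a $ n)"
  have shift: "(+) u ` cbox a b = cbox (u + a) (u + b)"
    by (rule cbox_translation[symmetric])
  have "?h (u + x) = ?h u + ?h x" for x
    by (simp add: vec_eq_iff)
  then have "?h ` (+) u ` cbox a b = (+) (?h u) ` ?h ` cbox a b"
    by (simp add: image_image)
  then have "measure lebesgue (?h ` cbox a b) = measure lebesgue (?h ` cbox (u + a) (u + b))"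
    by (simp only: measure_translation flip: shift)
  also have "\<dots> = measure lebesgue (cbox (u + a) (u + b))"
    using False shift by (intro measure_shear_interval assms) (auto simp: u_def axis_def)
  also have "\<dots> = measure lebesgue (cbox a b)"
    by (simp only: measure_translation flip: shift)
  finally show ?thesis .
qed simp

lemma measure_swap_cbox:
  fixes a b :: "real ^ 'n"
  shows "measure lebesgue ((\<lambda>v. \<chi> i. v $ Transposition.transpose m n i) ` cbox a b)
    = measure lebesgue (cbox a b)"
proof (cases "cbox a b = {}")
  case False
  let ?t = "Transposition.transpose m n"
  let ?h = "\<lambda>v :: real ^ 'n. \<chi> i. v $ ?t i"
  have "?h ` cbox a b = cbox (?h a) (?h b)"
  proof (intro set_eqI iffI)
    fix x assume x: "x \<in> cbox (?h a) (?h b)"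
    have "a $ i \<le> x $ ?t i \<and> x $ ?t i \<le> b $ i" for i
      using x unfolding mem_box_cart by (metis transpose_involutory vec_lambda_beta)
    then have "?h x \<in> cbox a b" by (simp add: mem_box_cart)
    moreover have "x = ?h (?h x)" by (simp add: vec_eq_iff)
    ultimately show "x \<in> ?h ` cbox a b" by (rule rev_image_eqI)
  qed (auto simp: mem_box_cart)
  moreover have "(\<Prod>i\<in>UNIV. b $ ?t i - a $ ?t i) = (\<Prod>i\<in>UNIV. b $ i - a $ i)"
    by (rule prod.reindex_bij_betw) simp
  moreover have "cbox (?h a) (?h b) \<noteq> {}"
    using False calculation(1) by blast
  ultimately show ?thesis
    using False by (simp add: content_cbox_cart)
qed simp

text \<open>Both sides are multiplicative in \<open>f\<close>, so it is enough to treat elementary maps. Determinants of shears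
  come from row operations and those of swaps from involutivity.\<close>

lemma measure_lebesgue_linear_image:
  fixes f :: "real ^ 'n \<Rightarrow> real ^ 'n"
  assumes "linear f" "S \<in> lmeasurable"
  shows "f ` S \<in> lmeasurable \<and> measure lebesgue (f ` S) = \<bar>det (matrix f)\<bar> * measure lebesgue S"
proof -
  let ?P = "\<lambda>f :: real ^ 'n \<Rightarrow> real ^ 'n. \<forall>S\<in>lmeasurable. f ` S \<in> lmeasurable \<and>
    measure lebesgue (f ` S) = \<bar>det (matrix f)\<bar> * measure lebesgue S"
  have from_boxes: "?P h"
    if "linear h" "\<bar>det (matrix h)\<bar> = 1"
      "\<And>a b. measure lebesgue (h ` cbox a b) = measure lebesgue (cbox a b)" for h
  proof
    fix S :: "(real ^ 'n) set" assume "S \<in> lmeasurable"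
    from measure_linear_sufficient[OF that(1) this, of 1] that(2,3)
    show "h ` S \<in> lmeasurable \<and> measure lebesgue (h ` S) = \<bar>det (matrix h)\<bar> * measure lebesgue S"
      by simp
  qed
  have "?P f"
  proof (rule induct_linear_elementary[OF assms(1)])
    fix f g :: "real ^ 'n \<Rightarrow> real ^ 'n"
    assume lin: "linear f" "linear g" and f: "?P f" and g: "?P g"
    have "\<bar>det (matrix (f \<circ> g))\<bar> = \<bar>det (matrix f)\<bar> * \<bar>det (matrix g)\<bar>"
      unfolding matrix_compose[OF lin(2,1)] det_mul abs_mult ..
    then show "?P (f \<circ> g)"
      using f g by (simp only: image_comp[symmetric] mult.assoc) simp
  next
    fix f :: "real ^ 'n \<Rightarrow> real ^ 'n" and i
    assume f: "linear f" "\<And>x. f x $ i = 0"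
    have "axis i 1 \<notin> range f"
      using f(2) by (metis axis_nth rangeE zero_neq_one)
    then have ninj: "\<not> inj f"
      using linear_injective_imp_surjective[OF f(1)] by blast
    then have "det (matrix f) = 0"
      using det_nz_iff_inj[OF f(1)] by blast
    moreover have "negligible (f ` S)" for S
      by (rule negligible_linear_singular_image[OF f(1) ninj])
    ultimately show "?P f"
      by (simp add: negligible_iff_measure)
  next
    fix c :: "'n \<Rightarrow> real"
    show "?P (\<lambda>x. \<chi> i. c i * x $ i)"
      by (simp add: measurable_stretch measure_stretch matrix_def axis_def det_diagonal)
  next
    fix m n :: 'n
    assume "m \<noteq> n"
    let ?h = "\<lambda>v :: real ^ 'n. \<chi> i. v $ Transposition.transpose m n i"
    have lin: "linear ?h"
      by (rule linearI) (simp_all add: vec_eq_iff)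
    have "?h \<circ> ?h = id"
      by (simp add: fun_eq_iff vec_eq_iff)
    then have "matrix ?h ** matrix ?h = mat 1"
      using matrix_compose[OF lin lin] matrix_id_mat_1 by metis
    then have "det (matrix ?h) * det (matrix ?h) = 1"
      by (metis det_I det_mul)
    then have "\<bar>det (matrix ?h)\<bar> = 1"
      by (auto simp: square_eq_1_iff)
    then show "?P ?h"
      using from_boxes[OF lin] measure_swap_cbox by blast
  next
    fix m n :: 'n
    assume mn: "m \<noteq> n"
    let ?h = "\<lambda>v :: real ^ 'n. \<chi> i. if i = m then v $ m + v $ n else v $ i"
    have lin: "linear ?h"
      by (rule linearI) (simp_all add: vec_eq_iff algebra_simps)
    show "?P ?h"
      using from_boxes[OF lin] measure_shear_cbox[OF mn] det_matrix_shear[OF mn] by simp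
  qed
  then show ?thesis using assms(2) by blast
qed

section \<open>Volume of a set whose lattice translates cover\<close>

text \<open>Cut the open unit cube into the pieces that it shares with the translates of \<open>K\<close>, and move every piece
  back into \<open>K\<close>. The moved pieces are disjoint because distinct integer translates of the cube are.\<close>

lemma covering_by_integer_translates_volume:
  fixes K :: "(real ^ 'n) set"
  assumes K: "K \<in> lmeasurable" and cov: "K + {z. \<forall>i. z $ i \<in> \<int>} = UNIV"
  shows "1 \<le> measure lebesgue K"
proof -
  define Z where "Z = {z :: real ^ 'n. \<forall>i. z $ i \<in> \<int>}"
  define Q where "Q = box (0 :: real ^ 'n) 1"
  have "Z = range (\<lambda>f :: 'n \<Rightarrow> int. \<chi> i. of_int (f i))"
  proof (intro set_eqI iffI)
    fix z assume "z \<in> Z"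
    then have "z $ i = of_int \<lfloor>z $ i\<rfloor>" for i
      by (simp add: Z_def)
    then have "z = (\<chi> i. of_int \<lfloor>z $ i\<rfloor>)"
      unfolding vec_eq_iff vec_lambda_beta by blast
    then show "z \<in> range (\<lambda>f :: 'n \<Rightarrow> int. \<chi> i. of_int (f i))" 
      by (rule image_eqI[where x = "\<lambda>i. \<lfloor>z $ i\<rfloor>"]) simp
  qed (auto simp: Z_def)
  then have "countable Z" by simp
  moreover have "infinite Z"
  proof (rule infinite_super)
    show "range (\<lambda>k. \<chi> i. of_nat k) \<subseteq> Z" by (auto simp: Z_def)
    show "infinite (range (\<lambda>k. (\<chi> i. of_nat k) :: real ^ 'n))"
      by (rule range_inj_infinite) (simp add: inj_on_def vec_eq_iff)
  qed
  ultimately obtain z :: "nat \<Rightarrow> real ^ 'n" where z: "bij_betw z UNIV Z"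
    using bij_betw_from_nat_into by blast
  define X where "X k = (+) (z k) ` K \<inter> Q" for k
  define Y where "Y k = (+) (- z k) ` X k" for k
  have shift: "emeasure lebesgue ((+) a ` S) = emeasure lebesgue S" for a :: "real ^ 'n" and S
    using emeasure_lebesgue_affine[of 1 a S] by (simp add: add.commute)
  have Xm: "X k \<in> sets lebesgue" for k
    using measurable_translation[OF K] by (auto simp: X_def Q_def fmeasurable_def)
  have Ym: "Y k \<in> sets lebesgue" for k
    using Xm lebesgue_sets_translation unfolding Y_def by blast
  have disj: "disjoint_family Y"
  proof (unfold disjoint_family_on_def, intro ballI impI, rule ccontr)
    fix k l assume "k \<noteq> l" "Y k \<inter> Y l \<noteq> {}"
    then obtain y where y: "z k + y \<in> Q" "z l + y \<in> Q"
      by (auto simp: Y_def X_def algebra_simps)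
    have "z k $ i = z l $ i" for i
    proof -
      have "z k \<in> Z" "z l \<in> Z" using z by (auto simp: bij_betw_def)
      then obtain a b where ab: "z k $ i = of_int a" "z l $ i = of_int b"
        unfolding Z_def by (metis Ints_cases mem_Collect_eq)
      have "0 < z k $ i + y $ i" "z k $ i + y $ i < 1" "0 < z l $ i + y $ i" "z l $ i + y $ i < 1"
        using y by (auto simp: Q_def mem_box_cart)
      then have "a < b + 1" "b < a + 1"
        unfolding ab by linarith+
      then have "a = b" by linarith
      then show ?thesis using ab by simp
    qed
    then have "z k = z l" by (simp add: vec_eq_iff)
    then show False using z \<open>k \<noteq> l\<close> by (auto simp: bij_betw_def dest: injD)
  qed
  have "Q \<subseteq> (\<Union>k. X k)"
  proof
    fix x assume x: "x \<in> Q"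
    have "x \<in> K + Z" using cov by (simp add: Z_def)
    then obtain c w where cw: "x = c + w" "c \<in> K" "w \<in> Z" by (rule set_plus_elim)
    obtain k where "w = z k" using z cw(3) unfolding bij_betw_def by blast
    then have "x \<in> X k"
      using x cw by (simp add: X_def add.commute)
    then show "x \<in> (\<Union>k. X k)" by blast
  qed
  moreover have "(\<Union>k. X k) \<in> sets lebesgue"
    using Xm by blast
  ultimately have "emeasure lebesgue Q \<le> emeasure lebesgue (\<Union>k. X k)"
    by (rule emeasure_mono)
  moreover have "emeasure lebesgue Q = 1"
  proof -
    have "emeasure lborel Q = ennreal (\<Prod>b\<in>Basis. (1 - 0 :: real ^ 'n) \<bullet> b)"
      unfolding Q_def by (rule emeasure_lborel_box) (auto simp: Basis_vec_def inner_axis)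
    also have "(\<Prod>b\<in>Basis. (1 - 0 :: real ^ 'n) \<bullet> b) = 1"
      by (rule prod.neutral) (auto simp: Basis_vec_def inner_axis)
    finally show ?thesis by (simp add: Q_def)
  qed
  ultimately have "1 \<le> emeasure lebesgue (\<Union>k. X k)"
    by simp
  also have "\<dots> \<le> (\<Sum>k. emeasure lebesgue (X k))"
    using Xm by (intro emeasure_subadditive_countably) auto
  also have "\<dots> = (\<Sum>k. emeasure lebesgue (Y k))"
    by (simp only: Y_def shift)
  also have "\<dots> = emeasure lebesgue (\<Union>k. Y k)"
    using Ym disj by (intro suminf_emeasure) auto
  also have "\<dots> \<le> emeasure lebesgue K"
    using K by (intro emeasure_mono) (auto simp: Y_def X_def fmeasurable_def)
  also have "\<dots> = ennreal (measure lebesgue K)"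
    using K by (simp add: emeasure_eq_measure2)
  finally show ?thesis by simp
qed

lemma lattice_covering_volume:
  fixes K :: "(real ^ 'n) set"
  assumes A: "lattice_basis A L" and K: "K \<in> lmeasurable" and cov: "K + L = UNIV"
  shows "\<bar>det A\<bar> \<le> measure lebesgue K"
proof -
  let ?Z = "{z :: real ^ 'n. \<forall>i. z $ i \<in> \<int>}"
  obtain B where B: "A ** B = mat 1" "B ** A = mat 1"
    using A by (auto simp: lattice_basis_def invertible_def)
  have L: "L = (*v) A ` ?Z"
    using A by (auto simp: lattice_basis_def)
  let ?f = "(*v) B"
  have fA: "?f (A *v x) = x" for x
    by (simp add: matrix_vector_mul_assoc B)
  have "?f ` K + ?Z = UNIV"
  proof -
    have "y \<in> ?f ` K + ?Z" for y
    proof -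
      have "A *v y \<in> K + L" by (simp add: cov)
      then obtain c z where cz: "c \<in> K" "z \<in> ?Z" "A *v y = c + A *v z"
        unfolding L by (elim set_plus_elim imageE) blast
      have "y = ?f (c + A *v z)" using fA[of y] cz(3) by simp
      then have "y = ?f c + z" by (simp add: matrix_vector_right_distrib fA)
      then show ?thesis using cz by (auto intro!: set_plus_intro)
    qed
    then show ?thesis by blast
  qed
  moreover have "?f ` K \<in> lmeasurable"
    and m: "measure lebesgue (?f ` K) = \<bar>det B\<bar> * measure lebesgue K"
    using measure_lebesgue_linear_image[of ?f, OF _ K] by (auto simp: matrix_of_matrix_vector_mul)
  ultimately have "1 \<le> \<bar>det B\<bar> * measure lebesgue K"
    using covering_by_integer_translates_volume by metis
  then have "\<bar>det A\<bar> * 1 \<le> \<bar>det A\<bar> * (\<bar>det B\<bar> * measure lebesgue K)"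
    by (intro mult_left_mono) auto
  also have "\<dots> = \<bar>det (A ** B)\<bar> * measure lebesgue K"
    by (simp add: det_mul abs_mult)
  also have "A ** B = mat 1"
    by (rule B)
  finally show ?thesis by simp
qed

section \<open>Volumes of cross-polytopes\<close>

text \<open>The \<open>2 ^ k\<close> reflections \<open>R T\<close> of the standard simplex in coordinate hyperplanes cover the
  cross-polytope.\<close>

lemma measure_cross_polytope_le:
  "measure lebesgue (cross_polytope :: (real ^ 'n) set) \<le> 2 ^ CARD('n) / fact CARD('n)"
proof -
  define D where "D = (convex hull (insert 0 Basis) :: (real ^ 'n) set)"
  have D: "D = {x. (\<forall>i. 0 \<le> x $ i) \<and> (\<Sum>i\<in>UNIV. x $ i) \<le> 1}"
  proof -
    have "(\<Sum>i\<in>Basis. x \<bullet> i) = (\<Sum>i\<in>UNIV. x $ i)" for x :: "real ^ 'n"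
      by (simp add: Basis_vec_def inner_axis sum.UNION_disjoint axis_eq_axis)
    then show ?thesis
      unfolding D_def std_simplex by (auto simp: Basis_vec_def inner_axis)
  qed
  have Dm: "D \<in> lmeasurable"
    unfolding D_def by (intro lmeasurable_compact finite_imp_compact_convex_hull) auto
  have "D \<in> sets borel"
    unfolding D_def by (intro borel_compact finite_imp_compact_convex_hull) auto
  then have vol: "measure lebesgue D = 1 / fact CARD('n)"
    unfolding D_def using content_std_simplex[where 'a = "real ^ 'n"] by simp
  define s :: "'n set \<Rightarrow> 'n \<Rightarrow> real" where "s T i = (if i \<in> T then -1 else 1)" for T i
  define R where "R T x = (\<chi> i. s T i * x $ i)" for T and x :: "real ^ 'n"
  have "\<bar>prod (s T) UNIV\<bar> = 1" for T
    unfolding abs_prod by (rule prod.neutral) (auto simp: s_def)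
  then have R: "R T ` D \<in> lmeasurable" "measure lebesgue (R T ` D) = 1 / fact CARD('n)" for T
    using measurable_stretch[OF Dm, of "s T"] measure_stretch[OF Dm, of "s T"] vol
    by (simp_all add: R_def[abs_def])
  have "cross_polytope \<subseteq> (\<Union>T\<in>UNIV. R T ` D)"
  proof
    fix x :: "real ^ 'n" assume x: "x \<in> cross_polytope"
    define T where "T = {i. x $ i < 0}"
    have "x = R T (\<chi> i. \<bar>x $ i\<bar>)"
      by (simp add: vec_eq_iff R_def s_def T_def)
    moreover have "(\<chi> i. \<bar>x $ i\<bar>) \<in> D"
      using x by (simp add: D cross_polytope_def)
    ultimately show "x \<in> (\<Union>T\<in>UNIV. R T ` D)" by blast
  qed
  moreover have "(\<Union>T\<in>UNIV. R T ` D) \<in> lmeasurable"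
    using R by (intro fmeasurable.finite_UN) auto
  moreover have "cross_polytope \<in> sets (lebesgue :: (real ^ 'n) measure)"
    using compact_scaled_cross_polytope[of 1, where 'a = 'n]
    by (simp add: lmeasurable_compact fmeasurableD)
  ultimately have "measure lebesgue (cross_polytope :: (real ^ 'n) set)
      \<le> measure lebesgue (\<Union>T\<in>UNIV. R T ` D)"
    by (intro measure_mono_fmeasurable)
  also have "\<dots> \<le> (\<Sum>T\<in>UNIV. measure lebesgue (R T ` D))"
    using R by (intro measure_UNION_le) (auto simp: fmeasurable_def)
  also have "\<dots> = 2 ^ CARD('n) / fact CARD('n)"
    by (simp add: R)
  finally show ?thesis .
qed

lemma measure_scaled_cross_polytope_le:
  assumes "0 \<le> r"
  shows "measure lebesgue ((*\<^sub>R) r ` (cross_polytope :: (real ^ 'n) set)) \<le> (2 * r) ^ CARD('n) / fact CARD('n)"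
proof -
  have "measure lebesgue ((*\<^sub>R) r ` (cross_polytope :: (real ^ 'n) set))
      = r ^ CARD('n) * measure lebesgue (cross_polytope :: (real ^ 'n) set)"
    using measure_lebesgue_affine[of r 0 "cross_polytope :: (real ^ 'n) set"] assms by simp
  also have "\<dots> \<le> r ^ CARD('n) * (2 ^ CARD('n) / fact CARD('n))"
    using assms by (intro mult_left_mono measure_cross_polytope_le) auto
  finally show ?thesis by (simp add: power_mult_distrib mult.commute)
qed

section \<open>Coverings by lattice translates\<close>

lemma lattice_diff_closed:
  assumes "lattice_basis A L" "u \<in> L" "v \<in> L"
  shows "u - v \<in> L"
proof -
  obtain x y where "u = A *v x" "v = A *v y" "\<forall>i. x $ i \<in> \<int>" "\<forall>i. y $ i \<in> \<int>"
    using assms by (auto simp: lattice_basis_def)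
  then have "u - v = A *v (x - y)" "\<forall>i. (x - y) $ i \<in> \<int>"
    by (auto simp: matrix_vector_mult_diff_distrib)
  then show ?thesis using assms(1) by (auto simp: lattice_basis_def)
qed

lemma lattice_add_multiple_closed:
  assumes "lattice_basis A L" "u \<in> L" "v \<in> L"
  shows "u + of_nat m *\<^sub>R v \<in> L"
proof -
  obtain x y where "u = A *v x" "v = A *v y" "\<forall>i. x $ i \<in> \<int>" "\<forall>i. y $ i \<in> \<int>"
    using assms by (auto simp: lattice_basis_def)
  then have "u + of_nat m *\<^sub>R v = A *v (x + of_nat m *\<^sub>R y)" "\<forall>i. (x + of_nat m *\<^sub>R y) $ i \<in> \<int>"
    by (auto simp: matrix_vector_right_distrib matrix_vector_mult_scaleR)
  then show ?thesis using assms(1) by (auto simp: lattice_basis_def)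
qed

text \<open>From a point of \<open>K\<close> step back by \<open>v\<close> for as long as the result stays in \<open>K\<close>; boundedness ends
  this. The last point in \<open>K\<close> is not in \<open>v + K\<close>, and it represents the same class modulo \<open>L\<close>. A
  single step would not do, as for short \<open>v\<close> its result may again lie in \<open>v + K\<close>.\<close>

lemma covering_without_overlap:
  assumes L: "lattice_basis A L" and v: "v \<in> L" "v \<noteq> 0"
    and K: "bounded K" and cov: "K + L = UNIV"
  shows "(K - (+) v ` K) + L = UNIV"
proof -
  have "y \<in> (K - (+) v ` K) + L" for y
  proof -
    obtain c w where cw: "c \<in> K" "w \<in> L" "y = c + w"
      using cov by (blast elim: set_plus_elim)
    define M where "M = {m :: nat. c - of_nat m *\<^sub>R v \<in> K}"
    obtain b where b: "\<And>x. x \<in> K \<Longrightarrow> norm x \<le> b"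
      using K by (auto simp: bounded_iff)
    have "finite M"
    proof (rule finite_subset)
      have "m \<le> nat \<lceil>2 * b / norm v\<rceil>" if "m \<in> M" for m
      proof -
        have "of_nat m * norm v = norm (c - (c - of_nat m *\<^sub>R v))" by simp
        also have "\<dots> \<le> norm c + norm (c - of_nat m *\<^sub>R v)" by (rule norm_triangle_ineq4)
        also have "\<dots> \<le> 2 * b" using b[OF cw(1)] b that unfolding M_def by fastforce
        finally have "of_nat m \<le> 2 * b / norm v" using v by (simp add: field_simps)
        then show ?thesis by linarith
      qed
      then show "M \<subseteq> {..nat \<lceil>2 * b / norm v\<rceil>}" by auto
    qed simp
    moreover have "0 \<in> M" using cw by (simp add: M_def)
    ultimately have m: "Max M \<in> M" "Suc (Max M) \<notin> M"
      by (metis Max_in empty_iff, metis Max_ge Suc_n_not_le_n)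
    define d where "d = c - of_nat (Max M) *\<^sub>R v"
    have "d \<in> K" using m(1) by (simp add: d_def M_def)
    moreover have "d \<notin> (+) v ` K"
    proof
      assume "d \<in> (+) v ` K"
      then have "d - v \<in> K" by auto
      moreover have "d - v = c - of_nat (Suc (Max M)) *\<^sub>R v"
        by (simp add: d_def scaleR_left_distrib)
      ultimately show False using m(2) by (simp add: M_def)
    qed
    moreover have "y = d + (w + of_nat (Max M) *\<^sub>R v)"
      using cw by (simp add: d_def)
    moreover have "w + of_nat (Max M) *\<^sub>R v \<in> L"
      by (rule lattice_add_multiple_closed[OF L cw(2) v(1)])
    ultimately show ?thesis using set_plus_intro[of d "K - (+) v ` K"] by simp
  qed
  then show ?thesis by blast
qed

text \<open>The image of the unit cube under \<open>A\<close> is a bounded fundamental domain. Without this the infimum in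
  \<open>covering_radius\<close> could be over the empty set, where it says nothing.\<close>

lemma lattice_covering_exists:
  fixes L :: "(real ^ 'n) set"
  assumes "lattice_basis A L"
  shows "\<exists>r>0. (*\<^sub>R) r ` cross_polytope + L = UNIV"
proof -
  obtain B where B: "A ** B = mat 1" and L: "L = (*v) A ` {z. \<forall>i. z $ i \<in> \<int>}"
    using assms by (auto simp: lattice_basis_def invertible_def)
  define M where "M = (\<Sum>i\<in>UNIV. \<Sum>j\<in>UNIV. \<bar>A $ i $ j\<bar>) + 1"
  have M: "M > 0" unfolding M_def by (smt (verit) sum_nonneg abs_ge_zero)
  have "y \<in> (*\<^sub>R) M ` cross_polytope + L" for y
  proof -
    define z where "z = (\<chi> i. real_of_int \<lfloor>(B *v y) $ i\<rfloor>)"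
    define f where "f = B *v y - z"
    have f: "\<bar>f $ i\<bar> \<le> 1" for i
      unfolding f_def z_def by (simp add: abs_le_iff) linarith
    have y: "A *v f + A *v z = y"
      by (simp add: f_def matrix_vector_mul_assoc B flip: matrix_vector_right_distrib)
    have "A *v z \<in> L" unfolding L by (rule imageI) (simp add: z_def)
    moreover have "l1 (A *v f) \<le> M"
    proof -
      have "\<bar>(A *v f) $ i\<bar> \<le> (\<Sum>j\<in>UNIV. \<bar>A $ i $ j\<bar>)" for i
      proof -
        have "\<bar>(A *v f) $ i\<bar> \<le> (\<Sum>j\<in>UNIV. \<bar>A $ i $ j * f $ j\<bar>)"
          by (simp add: matrix_vector_mult_def)
        also have "\<dots> \<le> (\<Sum>j\<in>UNIV. \<bar>A $ i $ j\<bar>)"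
          using f by (intro sum_mono) (simp add: abs_mult mult_left_le)
        finally show ?thesis .
      qed
      then have "l1 (A *v f) \<le> (\<Sum>i\<in>UNIV. \<Sum>j\<in>UNIV. \<bar>A $ i $ j\<bar>)"
        unfolding l1_def by (rule sum_mono)
      then show ?thesis by (simp add: M_def)
    qed
    then have "A *v f \<in> (*\<^sub>R) M ` cross_polytope"
      using mem_scaled_cross_polytope[OF M] by blast
    ultimately show ?thesis
      unfolding y[symmetric] by (intro set_plus_intro)
  qed
  then show ?thesis using M by blast
qed

text \<open>The ball of radius \<open>e / 2 * r\<close> about the midpoint of \<open>0\<close> and \<open>v\<close> lies in \<open>K\<close> and in \<open>v + K\<close>.\<close>

lemma measure_remainder_le:
  fixes v :: "real ^ 'n"
  assumes r: "0 < r" and e: "0 < e" "e \<le> 1" and v: "l1 v \<le> (2 - e) * r"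
  defines "K \<equiv> (*\<^sub>R) r ` (cross_polytope :: (real ^ 'n) set)"
  shows "measure lebesgue (K - (+) v ` K) \<le> (1 - (e / 2) ^ CARD('n)) * measure lebesgue K"
proof -
  have memK: "x \<in> K \<longleftrightarrow> l1 x \<le> r" for x
    unfolding K_def by (rule mem_scaled_cross_polytope[OF r])
  have compact_K: "compact K"
    unfolding K_def by (rule compact_scaled_cross_polytope[OF r])
  have Km: "K \<in> lmeasurable" "(+) v ` K \<in> lmeasurable"
    using compact_K by (auto intro: lmeasurable_compact measurable_translation)
  define B where "B = (\<lambda>x. (e / 2) *\<^sub>R x + (1/2) *\<^sub>R v) ` K"
  have half: "l1 ((e / 2) *\<^sub>R x + (1/2) *\<^sub>R u) \<le> r" if "l1 x \<le> r" "l1 u \<le> (2 - e) * r" for x u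
  proof -
    have "l1 ((e / 2) *\<^sub>R x + (1/2) *\<^sub>R u) \<le> e / 2 * l1 x + 1/2 * l1 u"
      using l1_triangle[of "(e / 2) *\<^sub>R x" "(1/2) *\<^sub>R u"] e by simp
    also have "\<dots> \<le> e / 2 * r + 1/2 * ((2 - e) * r)"
      using that e by (intro add_mono mult_left_mono) auto
    finally show ?thesis by (simp add: algebra_simps)
  qed
  have "B \<subseteq> K"
    using half[OF _ v] by (auto simp: B_def memK)
  moreover have "B \<subseteq> (+) v ` K"
  proof
    fix b assume "b \<in> B"
    then obtain x where x: "x \<in> K" "b = (e / 2) *\<^sub>R x + (1/2) *\<^sub>R v"
      by (auto simp: B_def)
    have "b = v + ((e / 2) *\<^sub>R x + (1/2) *\<^sub>R (- v))"
      using scaleR_half_double[of v] by (simp add: x(2) vec_eq_iff)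
    moreover have "(e / 2) *\<^sub>R x + (1/2) *\<^sub>R (- v) \<in> K"
      using half[of x "- v"] x(1) v by (simp add: memK)
    ultimately show "b \<in> (+) v ` K" by blast
  qed
  moreover have B: "B \<in> lmeasurable" "measure lebesgue B = (e / 2) ^ CARD('n) * measure lebesgue K"
  proof -
    show "B \<in> lmeasurable" unfolding B_def
      by (intro lmeasurable_compact compact_continuous_image compact_K continuous_intros)
    show "measure lebesgue B = (e / 2) ^ CARD('n) * measure lebesgue K"
      using measure_lebesgue_affine[of "e / 2" "(1/2) *\<^sub>R v" K] e by (simp add: B_def)
  qed
  ultimately have "measure lebesgue (K - (+) v ` K) \<le> measure lebesgue (K - B)"
    using Km by (intro measure_mono_fmeasurable fmeasurable.Diff) (auto simp: fmeasurable_def)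
  also have "\<dots> = measure lebesgue K - measure lebesgue B"
    using Km B \<open>B \<subseteq> K\<close> by (intro measurable_measure_Diff) (auto simp: fmeasurable_def)
  finally show ?thesis using B by (simp add: algebra_simps)
qed

text \<open>Dividing by \<open>r\<close> turns the covering into one by unit cross-polytopes, so the overlap hypothesis supplies
  a short lattice vector \<open>v\<close>; removing the overlap with the translate by \<open>v\<close> improves the volume bound by
  the factor \<open>1 - (e / 2) ^ k\<close>.\<close>

lemma lattice_covering_scale_bound:
  fixes L :: "(real ^ 'n) set"
  assumes e: "0 < e" "e \<le> 1"
    and overlap: "\<And>S :: (real ^ 'n) set. S + cross_polytope = UNIV \<Longrightarrow>
      \<exists>p\<in>S. \<exists>q\<in>S. p \<noteq> q \<and> l1 (p - q) < 2 - e"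
    and L: "lattice_basis A L" and det: "\<bar>det A\<bar> = 1"
    and r: "0 < r" and cov: "(*\<^sub>R) r ` cross_polytope + L = UNIV"
  shows "fact CARD('n) \<le> (1 - (e / 2) ^ CARD('n)) * (2 * r) ^ CARD('n)"
proof -
  define K where "K = (*\<^sub>R) r ` (cross_polytope :: (real ^ 'n) set)"
  define S where "S = (\<lambda>x. x /\<^sub>R r) ` L"
  have "y \<in> S + cross_polytope" for y
  proof -
    have "r *\<^sub>R y \<in> (*\<^sub>R) r ` cross_polytope + L" by (simp add: cov)
    then obtain c w where cw: "c \<in> cross_polytope" "w \<in> L" "r *\<^sub>R y = r *\<^sub>R c + w"
      by (elim set_plus_elim imageE) blast
    have "y = (r *\<^sub>R y) /\<^sub>R r" using r by simp
    also have "\<dots> = w /\<^sub>R r + c" using r unfolding cw(3) by (simp add: scaleR_right_distrib)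
    finally show ?thesis using cw unfolding S_def by (blast intro: set_plus_intro)
  qed
  then obtain p q where pq: "p \<in> L" "q \<in> L" "p /\<^sub>R r \<noteq> q /\<^sub>R r" "l1 (p /\<^sub>R r - q /\<^sub>R r) < 2 - e"
    using overlap[of S] unfolding S_def by blast
  define v where "v = p - q"
  have v: "v \<in> L" "v \<noteq> 0"
    using pq lattice_diff_closed[OF L] by (auto simp: v_def)
  have "l1 v / r < 2 - e"
    using pq(4) r by (simp add: v_def divide_inverse mult.commute flip: scaleR_diff_right)
  then have lv: "l1 v \<le> (2 - e) * r" using r by (simp add: field_simps)
  have "compact K"
    unfolding K_def by (rule compact_scaled_cross_polytope[OF r])
  then have "K \<in> lmeasurable" "bounded K"
    by (simp_all add: lmeasurable_compact compact_imp_bounded)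
  then have "K - (+) v ` K \<in> lmeasurable" "bounded K"
    using measurable_translation by (blast intro: fmeasurable_Diff fmeasurableD)+
  moreover from this have "(K - (+) v ` K) + L = UNIV"
    using cov unfolding K_def by (intro covering_without_overlap[OF L v])
  ultimately have "1 \<le> measure lebesgue (K - (+) v ` K)"
    using lattice_covering_volume[OF L] det by metis
  also have "\<dots> \<le> (1 - (e / 2) ^ CARD('n)) * measure lebesgue K"
    using measure_remainder_le[OF r e lv] by (simp add: K_def)
  also have "\<dots> \<le> (1 - (e / 2) ^ CARD('n)) * ((2 * r) ^ CARD('n) / fact CARD('n))"
    using measure_scaled_cross_polytope_le[of r] r e
    by (intro mult_left_mono) (auto simp: K_def power_le_one)
  finally show ?thesis by (simp add: field_simps)
qed

section \<open>Non-existence of tilings and the gap in the covering radius\<close>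

theorem proposition2:
  assumes "CARD('n::finite) \<ge> 3"
  shows "(\<nexists>P :: (real ^ 'n) set. P + cross_polytope = UNIV \<and>
            (\<forall>r\<in>P. \<forall>s\<in>P. r \<noteq> s \<longrightarrow>
               ((+) r ` interior cross_polytope) \<inter> ((+) s ` interior cross_polytope) = {}))
         \<and> min_covering_radius (cross_polytope :: (real ^ 'n) set)
             > 1/2 * fact CARD('n) powr (1 / real CARD('n))"
proof
  let ?k = "CARD('n)"
  obtain e where e: "0 < e" "e \<le> 1"
    and overlap: "\<And>S :: (real ^ 'n) set. S + cross_polytope = UNIV \<Longrightarrow>
      \<exists>p\<in>S. \<exists>q\<in>S. p \<noteq> q \<and> l1 (p - q) < 2 - e"
    using covering_is_not_nearly_packing[OF assms] by blast
  show "\<nexists>P :: (real ^ 'n) set. P + cross_polytope = UNIV \<and>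
            (\<forall>r\<in>P. \<forall>s\<in>P. r \<noteq> s \<longrightarrow>
               ((+) r ` interior cross_polytope) \<inter> ((+) s ` interior cross_polytope) = {})"
  proof (intro notI, elim exE conjE)
    fix P :: "(real ^ 'n) set"
    assume "P + cross_polytope = UNIV"
      and disj: "\<forall>r\<in>P. \<forall>s\<in>P. r \<noteq> s \<longrightarrow>
        ((+) r ` interior cross_polytope) \<inter> ((+) s ` interior cross_polytope) = {}"
    then obtain p q where "p \<in> P" "q \<in> P" "p \<noteq> q" "l1 (p - q) < 2 - e"
      using overlap by blast
    then show False
      using disj disjoint_interiors_imp_l1_ge[of p q] e(1) by fastforce
  qed
  define t where "t = 1 - (e / 2) ^ ?k"
  have t: "0 < t" "t < 1"
  proof -
    have "(e / 2) ^ ?k < 1" using e assms by (intro power_less_one_iff[THEN iffD2]) auto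
    then show "0 < t" "t < 1" using e by (auto simp: t_def)
  qed
  \<comment> \<open>The lower bound on \<open>r\<close> obtained by solving the scale bound for \<open>r\<close>; it exceeds the claimed one
    because \<open>t < 1\<close>.\<close>
  define \<rho> where "\<rho> = 1/2 * (fact ?k / t) powr (1 / real ?k)"
  have bound: "\<rho> \<le> r"
    if "lattice_basis A L" "\<bar>det A\<bar> = 1" "0 < r" "(*\<^sub>R) r ` cross_polytope + L = UNIV"
    for A and L :: "(real ^ 'n) set" and r
  proof -
    have "fact ?k / t \<le> (2 * r) ^ ?k"
      using lattice_covering_scale_bound[OF e overlap that] t by (simp add: t_def field_simps)
    then have "(fact ?k / t) powr (1 / real ?k) \<le> ((2 * r) ^ ?k) powr (1 / real ?k)"
      using t by (intro powr_mono2) auto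
    also have "\<dots> = 2 * r"
    proof -
      have eq: "(2 * r) ^ ?k = (2 * r) powr real ?k"
        using that(3) by (simp add: powr_realpow)
      show ?thesis unfolding eq powr_powr using that(3) by simp
    qed
    finally show ?thesis by (simp add: \<rho>_def)
  qed
  have radius: "\<rho> \<le> covering_radius cross_polytope L"
    if L: "L \<in> unimodular_lattices" for L :: "(real ^ 'n) set"
  proof -
    obtain A where A: "lattice_basis A L" "\<bar>det A\<bar> = 1"
      using L covolume_eq unfolding unimodular_lattices_def is_lattice_def by fastforce
    show ?thesis unfolding covering_radius_def
    proof (rule cInf_greatest)
      show "{r. 0 < r \<and> (*\<^sub>R) r ` cross_polytope + L = UNIV} \<noteq> {}"
        using lattice_covering_exists[OF A(1)] by blast
    qed (use bound[OF A] in blast)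
  qed
  have "(unimodular_lattices :: (real ^ 'n) set set) \<noteq> {}"
  proof -
    define Z where "Z = (*v) (mat 1 :: real ^ 'n ^ 'n) ` {z. \<forall>i. z $ i \<in> \<int>}"
    have "invertible (mat 1 :: real ^ 'n ^ 'n)"
      by (simp add: invertible_det_nz)
    then have Z: "lattice_basis (mat 1) Z"
      by (simp add: lattice_basis_def Z_def)
    then have "is_lattice Z" "covolume Z = 1"
      using covolume_eq[OF Z] by (auto simp: is_lattice_def)
    then show ?thesis by (auto simp: unimodular_lattices_def)
  qed
  then have "\<rho> \<le> min_covering_radius (cross_polytope :: (real ^ 'n) set)"
    unfolding min_covering_radius_def using radius by (intro cINF_greatest)
  moreover have "1/2 * fact ?k powr (1 / real ?k) < \<rho>"
  proof -
    have "(fact ?k :: real) < fact ?k / t" using t by (simp add: field_simps)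
    then show ?thesis by (simp add: \<rho>_def powr_less_mono2)
  qed
  ultimately show "1/2 * fact ?k powr (1 / real ?k) < min_covering_radius (cross_polytope :: (real ^ 'n) set)"
    by linarith
qed

end
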